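(* Let $m\ge1$, $X=\{x_0,x_1,\ldots,x_m\}$, and let $H$ be the connected graded Hopf algebra of coordinate functions $a^k_\eta$ ($\eta\in X^*$, $1\le k\le m$) described in the context. For any nonempty word $\eta=x_{i_1}\cdots x_{i_l}\in X^*$ and any $1\le k\le m$, the antipode $S:H\to H$ satisfies $$S a^k_\eta = (-1)^{|\eta|+1}\,\tilde\Theta'_{\eta}(a^k_{\mathrm{e}}),$$ where $|\eta|=l$ is the length of $\eta$, $$\tilde\Theta'_{\eta}:=\tilde\theta'_{i_l}\circ\cdots\circ\tilde\theta'_{i_1},$$ and, for $0\le i\le m$, $$\tilde\theta'_{i}:=-\tilde\theta_{i}+\delta_{0i}\sum_{j=1}^{m}a^{j}_{\mathrm{e}}\,\tilde\theta_{j}.$$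
   Context: $X^*$ is the monoid of words over $X$, including the empty word $\mathrm{e}=\emptyset$; $\delta_{0i}$ is the Kronecker delta. $H$ is the free commutative real polynomial algebra with unit $\mathbf 1$ on the symbols $a^i_\eta$ ($\eta\in X^*$, $1\le i\le m$), graded by $\deg(\mathbf 1)=0$, $\deg(a^i_\eta)=1+2|\eta|_0+|\eta|_1$ (additive on products), where $|\eta|_0$ is the number of letters $x_0$ in $\eta$ and $|\eta|_1$ the number of letters $x_j$, $j\ne0$. For $0\le j\le m$, $\tilde\theta_j:H\to H$ is the derivation with $\tilde\theta_j a^k_\eta=a^k_{\eta x_j}$ and $\tilde\theta_j\mathbf 1=0$. For $1\le j\le m$, $A^{(j)}_{\mathrm{e}}:H\to H$ is multiplication by $a^j_{\mathrm{e}}$. In $\tilde\theta'_i$, the term $a^j_{\mathrm{e}}\tilde\theta_j$ means: apply $\tilde\theta_j$, then multiply by $a^j_{\mathrm{e}}$; thus $\tilde\theta'_i$ is a derivation of $H$. The coproduct $\Delta:H\to H\otimes H$ is the algebra morphism with $\Delta a^l_\eta=\tilde\Theta_\eta(a^l_{\mathrm{e}}\otimes\mathbf 1+\mathbf 1\otimes a^l_{\mathrm{e}})$, where for $\eta=x_{i_1}\cdots x_{i_n}$, $\tilde\Theta_\eta:=\tilde\Theta_{i_n}\circ\cdots\circ\tilde\Theta_{i_1}$ and $$\tilde\Theta_i:=\tilde\theta_i\otimes\mathrm{id}+\mathrm{id}\otimes\tilde\theta_i+\delta_{0i}\sum_{j=1}^m\tilde\theta_j\otimes A^{(j)}_{\mathrm{e}}.$$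 The counit $\epsilon$ is the algebra map vanishing on all $a^i_\eta$. With these data $H$ is a connected graded commutative Hopf algebra, and $S$ denotes its antipode (the convolution inverse of $\mathrm{id}_H$). *)

theory Defs
  imports Complex_Main "HOL-Library.Poly_Mapping" "HOL-Library.Product_Plus"
begin

section \<open>Real algebras of finitely supported functions\<close>

instantiation poly_mapping :: (type, real_vector) real_vector
begin

lift_definition scaleR_poly_mapping :: "real \<Rightarrow> ('a \<Rightarrow>\<^sub>0 'b) \<Rightarrow> 'a \<Rightarrow>\<^sub>0 'b"
  is "\<lambda>c f x. c *\<^sub>R f x"
  by (erule rev_finite_subset) auto

instance
  by standard (transfer; simp add: fun_eq_iff algebra_simps)+

end

lemma lookup_scaleR [simp]: "Poly_Mapping.lookup (c *\<^sub>R p) x = c *\<^sub>R Poly_Mapping.lookup p x"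
  by transfer simp

lemma scaleR_single: "c *\<^sub>R Poly_Mapping.single x a = Poly_Mapping.single x (c *\<^sub>R a)"
  by (rule poly_mapping_eqI) (simp add: lookup_single when_def)

instance poly_mapping :: (comm_monoid_add, "{real_algebra, comm_ring_1}") real_algebra
proof
  fix a :: real and x y :: "'a \<Rightarrow>\<^sub>0 'b"
  have *: "a *\<^sub>R z = Poly_Mapping.single 0 (a *\<^sub>R 1) * z" for z :: "'a \<Rightarrow>\<^sub>0 'b"
  proof -
    have "Poly_Mapping.single 0 (a *\<^sub>R 1) * z = Poly_Mapping.map ((*) (a *\<^sub>R 1)) z"
      by (simp add: mult_map_scale_conv_mult)
    also have "\<dots> = a *\<^sub>R z"
      by (rule poly_mapping_eqI) (simp add: Poly_Mapping.map.rep_eq when_def)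
    finally show ?thesis by simp
  qed
  show "a *\<^sub>R x * y = a *\<^sub>R (x * y)" "x * a *\<^sub>R y = a *\<^sub>R (x * y)"
    by (simp_all add: * ac_simps)
qed

instance poly_mapping :: (comm_monoid_add, "{real_algebra_1, comm_ring_1}") real_algebra_1 ..

text \<open>Linear extension of a function given on the basis of the free vector space.\<close>

definition lin_ext :: "('a \<Rightarrow> 'b::real_vector) \<Rightarrow> ('a \<Rightarrow>\<^sub>0 real) \<Rightarrow> 'b" where
  "lin_ext f p = (\<Sum>x\<in>Poly_Mapping.keys p. Poly_Mapping.lookup p x *\<^sub>R f x)"

lemma lin_ext_superset:
  assumes "finite A" "Poly_Mapping.keys p \<subseteq> A"
  shows "lin_ext f p = (\<Sum>x\<in>A. Poly_Mapping.lookup p x *\<^sub>R f x)"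
  unfolding lin_ext_def
  by (rule sum.mono_neutral_left) (use assms in \<open>auto simp: in_keys_iff\<close>)

lemma linear_lin_ext: "linear (lin_ext f)"
proof
  fix p q :: "'a \<Rightarrow>\<^sub>0 real" and c :: real
  let ?A = "Poly_Mapping.keys p \<union> Poly_Mapping.keys q"
  have "Poly_Mapping.keys (p + q) \<subseteq> ?A" by (rule keys_add)
  then show "lin_ext f (p + q) = lin_ext f p + lin_ext f q"
    by (simp add: lin_ext_superset[of ?A] lookup_add scaleR_add_left sum.distrib)
  have "Poly_Mapping.keys (c *\<^sub>R p) \<subseteq> Poly_Mapping.keys p" by (auto simp: in_keys_iff)
  then show "lin_ext f (c *\<^sub>R p) = c *\<^sub>R lin_ext f p"
    by (simp add: lin_ext_superset[of "Poly_Mapping.keys p"] scaleR_sum_right)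
qed

lemma lin_ext_single [simp]: "lin_ext f (Poly_Mapping.single x c) = c *\<^sub>R f x"
  by (simp add: lin_ext_superset[of "{x}"])

lemma lin_ext_basis [simp]: "lin_ext (\<lambda>x. Poly_Mapping.single x 1) p = p"
  by (rule poly_mapping_eqI)
     (auto simp: lin_ext_def lookup_sum lookup_single when_def in_keys_iff if_distrib
        sum.delta cong: if_cong)

lemma linear_eq_lin_ext:
  assumes "linear f"
  shows "f p = lin_ext (\<lambda>x. f (Poly_Mapping.single x 1)) p"
proof -
  have "f p = f (lin_ext (\<lambda>x. Poly_Mapping.single x 1) p)"
    by (simp only: lin_ext_basis)
  also have "\<dots> = lin_ext (\<lambda>x. f (Poly_Mapping.single x 1)) p"
    by (simp only: lin_ext_def linear_sum[OF assms] linear_scale[OF assms])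
  finally show ?thesis .
qed

lemma linear_eq_on_basis:
  fixes f g :: "('a \<Rightarrow>\<^sub>0 real) \<Rightarrow> 'b::real_vector"
  assumes "linear f" "linear g"
    "\<And>x. f (Poly_Mapping.single x 1) = g (Poly_Mapping.single x 1)"
  shows "f p = g p"
  unfolding linear_eq_lin_ext[OF assms(1), of p] linear_eq_lin_ext[OF assms(2), of p]
  by (simp only: assms(3))

section \<open>Polynomial algebras\<close>

text \<open>
  A monomial in the variables \<open>'v\<close> is its exponent vector, so \<open>'v mpoly\<close> is the free commutative
  real algebra on \<open>'v\<close>, with multiplication and unit taken from the library (convolution).
\<close>

type_synonym 'v mono = "'v \<Rightarrow>\<^sub>0 nat"
type_synonym 'v mpoly = "'v mono \<Rightarrow>\<^sub>0 real"

definition var :: "'v \<Rightarrow> 'v mpoly" where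
  "var v = Poly_Mapping.single (Poly_Mapping.single v 1) 1"

text \<open>The algebra morphism with prescribed values on the variables.\<close>

definition alg_ext :: "('v \<Rightarrow> 'b::{real_algebra_1, comm_ring_1}) \<Rightarrow> 'v mpoly \<Rightarrow> 'b" where
  "alg_ext f = lin_ext (\<lambda>u. \<Prod>v\<in>Poly_Mapping.keys u. f v ^ Poly_Mapping.lookup u v)"

text \<open>The derivation with prescribed values on the variables.\<close>

definition deriv_ext :: "('v \<Rightarrow> 'v mpoly) \<Rightarrow> 'v mpoly \<Rightarrow> 'v mpoly" where
  "deriv_ext d = lin_ext (\<lambda>u. \<Sum>v\<in>Poly_Mapping.keys u.
     real (Poly_Mapping.lookup u v) *\<^sub>R (Poly_Mapping.single (u - Poly_Mapping.single v 1) 1 * d v))"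

lemma bilinear_eq_on_basis:
  fixes f g :: "('a \<Rightarrow>\<^sub>0 real) \<Rightarrow> ('c \<Rightarrow>\<^sub>0 real) \<Rightarrow> 'b::real_vector"
  assumes "\<And>q. linear (\<lambda>p. f p q)" "\<And>p. linear (f p)"
    "\<And>q. linear (\<lambda>p. g p q)" "\<And>p. linear (g p)"
    "\<And>x y. f (Poly_Mapping.single x 1) (Poly_Mapping.single y 1)
          = g (Poly_Mapping.single x 1) (Poly_Mapping.single y 1)"
  shows "f p q = g p q"
proof -
  have "f (Poly_Mapping.single x 1) q = g (Poly_Mapping.single x 1) q" for x
    by (rule linear_eq_on_basis[OF assms(2,4)]) (rule assms(5))
  then show ?thesis
    by (rule linear_eq_on_basis[OF assms(1,3)])
qed

lemma linear_alg_ext: "linear (alg_ext f)"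
  unfolding alg_ext_def by (rule linear_lin_ext)

lemma linear_deriv_ext: "linear (deriv_ext d)"
  unfolding deriv_ext_def by (rule linear_lin_ext)

lemma alg_ext_var [simp]: "alg_ext f (var v) = f v"
  by (simp add: alg_ext_def var_def)

lemma alg_ext_one [simp]: "alg_ext f 1 = 1"
  by (simp add: alg_ext_def flip: single_one)

lemma alg_ext_mult: "alg_ext f (p * q) = alg_ext f p * alg_ext f q"
proof (rule bilinear_eq_on_basis[where f = "\<lambda>p q. alg_ext f (p * q)"
      and g = "\<lambda>p q. alg_ext f p * alg_ext f q"])
  let ?m = "\<lambda>u. \<Prod>v\<in>Poly_Mapping.keys u. f v ^ Poly_Mapping.lookup u v"
  have m: "?m u = (\<Prod>v\<in>A. f v ^ Poly_Mapping.lookup u v)" if "finite A" "Poly_Mapping.keys u \<subseteq> A" for u A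
    by (rule prod.mono_neutral_left) (use that in \<open>auto simp: in_keys_iff\<close>)
  have "?m (x + y) = ?m x * ?m y" for x y
  proof -
    let ?A = "Poly_Mapping.keys x \<union> Poly_Mapping.keys y"
    have "?m (x + y) = (\<Prod>v\<in>?A. f v ^ Poly_Mapping.lookup (x + y) v)"
      by (rule m) (simp_all add: keys_add)
    also have "\<dots> = (\<Prod>v\<in>?A. f v ^ Poly_Mapping.lookup x v) * (\<Prod>v\<in>?A. f v ^ Poly_Mapping.lookup y v)"
      by (simp only: lookup_add power_add prod.distrib)
    also have "\<dots> = ?m x * ?m y"
      using m[of ?A x] m[of ?A y] by simp
    finally show ?thesis .
  qed
  then show "alg_ext f (Poly_Mapping.single x 1 * Poly_Mapping.single y 1)
      = alg_ext f (Poly_Mapping.single x 1) * alg_ext f (Poly_Mapping.single y 1)" for x y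
    by (simp add: alg_ext_def mult_single)
qed (rule linearI;
     simp add: linear_add[OF linear_alg_ext] linear_scale[OF linear_alg_ext] algebra_simps)+

lemma deriv_ext_var [simp]: "deriv_ext d (var v) = d v"
  by (simp add: deriv_ext_def var_def)

lemma deriv_ext_one [simp]: "deriv_ext d 1 = 0"
  by (simp add: deriv_ext_def flip: single_one)

lemma deriv_ext_mult: "deriv_ext d (p * q) = deriv_ext d p * q + p * deriv_ext d q"
proof (rule bilinear_eq_on_basis[where f = "\<lambda>p q. deriv_ext d (p * q)"
      and g = "\<lambda>p q. deriv_ext d p * q + p * deriv_ext d q"])
  let ?s = "\<lambda>u. Poly_Mapping.single u (1::real)"
  let ?t = "\<lambda>u v. real (Poly_Mapping.lookup u v) *\<^sub>R (?s (u - Poly_Mapping.single v 1) * d v)"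
  have m: "(\<Sum>v\<in>Poly_Mapping.keys u. ?t u v) = (\<Sum>v\<in>A. ?t u v)" if "finite A" "Poly_Mapping.keys u \<subseteq> A" for u A
    by (rule sum.mono_neutral_left) (use that in \<open>auto simp: in_keys_iff\<close>)
  have shift: "Poly_Mapping.lookup x v *\<^sub>R ?s (x + y - Poly_Mapping.single v 1)
      = Poly_Mapping.lookup x v *\<^sub>R (?s (x - Poly_Mapping.single v 1) * ?s y)" for x y :: "'a mono" and v
  proof (cases "Poly_Mapping.lookup x v = 0")
    case False
    then have "x + y - Poly_Mapping.single v 1 = x - Poly_Mapping.single v 1 + y"
      by (intro poly_mapping_eqI) (auto simp: lookup_add lookup_minus lookup_single when_def)
    then show ?thesis by (simp add: mult_single)
  qed simp
  have *: "?t (x + y) v = ?t x v * ?s y + ?s x * ?t y v" for x y v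
  proof -
    have "?t (x + y) v = (Poly_Mapping.lookup x v *\<^sub>R ?s (x + y - Poly_Mapping.single v 1)
        + Poly_Mapping.lookup y v *\<^sub>R ?s (y + x - Poly_Mapping.single v 1)) * d v"
      by (simp add: lookup_add scaleR_add_left distrib_right add.commute)
    also have "\<dots> = ?t x v * ?s y + ?s x * ?t y v"
      unfolding shift by (simp add: algebra_simps)
    finally show ?thesis .
  qed
  show "deriv_ext d (?s x * ?s y) = deriv_ext d (?s x) * ?s y + ?s x * deriv_ext d (?s y)" for x y
  proof -
    let ?A = "Poly_Mapping.keys x \<union> Poly_Mapping.keys y"
    have "deriv_ext d (?s x * ?s y) = (\<Sum>v\<in>?A. ?t (x + y) v)"
      using m[of ?A "x + y"] keys_add[of x y] by (simp add: deriv_ext_def mult_single)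
    also have "\<dots> = (\<Sum>v\<in>?A. ?t x v) * ?s y + ?s x * (\<Sum>v\<in>?A. ?t y v)"
      unfolding * by (simp only: sum.distrib sum_distrib_left sum_distrib_right)
    also have "(\<Sum>v\<in>?A. ?t x v) = deriv_ext d (?s x)"
      using m[of ?A x] by (simp add: deriv_ext_def)
    also have "(\<Sum>v\<in>?A. ?t y v) = deriv_ext d (?s y)"
      using m[of ?A y] by (simp add: deriv_ext_def)
    finally show ?thesis .
  qed
qed (rule linearI;
     simp add: linear_add[OF linear_deriv_ext] linear_scale[OF linear_deriv_ext] algebra_simps)+

section \<open>Tensor products\<close>

text \<open>
  The tensor square of the polynomial algebra has the pairs of monomials as a basis; its product
  (convolution over the product monoid) satisfies \<open>(p \<otimes> q)(p' \<otimes> q') = pp' \<otimes> qq'\<close>.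
\<close>

type_synonym 'v mpoly2 = "('v mono \<times> 'v mono) \<Rightarrow>\<^sub>0 real"

definition tensor :: "'v mpoly \<Rightarrow> 'v mpoly \<Rightarrow> 'v mpoly2"  (infixl \<open>\<otimes>\<close> 75) where
  "p \<otimes> q = lin_ext (\<lambda>u. lin_ext (\<lambda>w. Poly_Mapping.single (u, w) 1) q) p"

definition tensor_map ::
  "('v mpoly \<Rightarrow> 'v mpoly) \<Rightarrow> ('v mpoly \<Rightarrow> 'v mpoly) \<Rightarrow> 'v mpoly2 \<Rightarrow> 'v mpoly2"
where
  "tensor_map f g = lin_ext (\<lambda>(u, w). f (Poly_Mapping.single u 1) \<otimes> g (Poly_Mapping.single w 1))"

definition mult_tensor :: "'v mpoly2 \<Rightarrow> 'v mpoly" where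
  "mult_tensor = lin_ext (\<lambda>(u, w). Poly_Mapping.single u 1 * Poly_Mapping.single w 1)"

lemma linear_tensor_left: "linear (\<lambda>p. p \<otimes> q)"
  unfolding tensor_def by (rule linear_lin_ext)

lemma linear_tensor_right: "linear (\<lambda>q. p \<otimes> q)"
proof (rule linearI)
  fix q q' :: "'a mpoly" and c :: real
  show "p \<otimes> (q + q') = p \<otimes> q + p \<otimes> q'"
    unfolding tensor_def linear_add[OF linear_lin_ext]
    by (simp only: lin_ext_def[of _ p] scaleR_add_right sum.distrib)
  show "p \<otimes> (c *\<^sub>R q) = c *\<^sub>R (p \<otimes> q)"
    unfolding tensor_def linear_scale[OF linear_lin_ext]
    by (simp only: lin_ext_def[of _ p] scaleR_left_commute[of _ c] scaleR_sum_right)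
qed

lemma tensor_single [simp]:
  "Poly_Mapping.single u a \<otimes> Poly_Mapping.single w b = Poly_Mapping.single (u, w) (a * b)"
  by (simp add: tensor_def scaleR_single)

lemma linear_tensor_map: "linear (tensor_map f g)"
  unfolding tensor_map_def by (rule linear_lin_ext)

lemma linear_mult_tensor: "linear mult_tensor"
  unfolding mult_tensor_def by (rule linear_lin_ext)

lemmas tensor_linear =
  linear_add[OF linear_tensor_left] linear_scale[OF linear_tensor_left]
  linear_add[OF linear_tensor_right] linear_scale[OF linear_tensor_right]

lemma tensor_map_tensor:
  assumes "linear f" "linear g"
  shows "tensor_map f g (p \<otimes> q) = f p \<otimes> g q"
proof (rule bilinear_eq_on_basis[where f = "\<lambda>p q. tensor_map f g (p \<otimes> q)"
      and g = "\<lambda>p q. f p \<otimes> g q"])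
  show "tensor_map f g (Poly_Mapping.single x 1 \<otimes> Poly_Mapping.single y 1)
      = f (Poly_Mapping.single x 1) \<otimes> g (Poly_Mapping.single y 1)" for x y
    by (simp add: tensor_map_def)
qed (rule linearI; simp add: tensor_linear linear_add[OF linear_tensor_map]
      linear_scale[OF linear_tensor_map] linear_add[OF assms(1)] linear_add[OF assms(2)]
      linear_scale[OF assms(1)] linear_scale[OF assms(2)])+

lemma mult_tensor_tensor: "mult_tensor (p \<otimes> q) = p * q"
proof (rule bilinear_eq_on_basis[where f = "\<lambda>p q. mult_tensor (p \<otimes> q)"
      and g = "\<lambda>p q. p * q"])
  show "mult_tensor (Poly_Mapping.single x 1 \<otimes> Poly_Mapping.single y 1)
      = Poly_Mapping.single x 1 * Poly_Mapping.single y 1" for x y :: "'a mono"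
    by (simp add: mult_tensor_def)
qed (rule linearI; simp add: tensor_linear linear_add[OF linear_mult_tensor]
      linear_scale[OF linear_mult_tensor] algebra_simps)+

lemma tensor_mult: "(p \<otimes> q) * (p' \<otimes> q') = (p * p') \<otimes> (q * q')"
proof -
  let ?s = "\<lambda>u. Poly_Mapping.single u (1::real)"
  have basis: "(?s u \<otimes> ?s w) * (p' \<otimes> q') = (?s u * p') \<otimes> (?s w * q')" for u w
  proof (rule bilinear_eq_on_basis[where f = "\<lambda>p q. (?s u \<otimes> ?s w) * (p \<otimes> q)"
      and g = "\<lambda>p q. (?s u * p) \<otimes> (?s w * q)"])
    show "(?s u \<otimes> ?s w) * (?s x \<otimes> ?s y) = (?s u * ?s x) \<otimes> (?s w * ?s y)" for x y
      by (simp add: mult_single)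
  qed (rule linearI; simp add: tensor_linear distrib_left distrib_right)+
  show ?thesis
  proof (rule bilinear_eq_on_basis[where f = "\<lambda>p q. (p \<otimes> q) * (p' \<otimes> q')"
        and g = "\<lambda>p q. (p * p') \<otimes> (q * q')"])
    show "(?s u \<otimes> ?s w) * (p' \<otimes> q') = (?s u * p') \<otimes> (?s w * q')" for u w
      by (rule basis)
  qed (rule linearI; simp add: tensor_linear distrib_left distrib_right)+
qed

section \<open>The Hopf algebra of coordinate functions\<close>

text \<open>
  \<open>'m\<close> is the index set of the letters \<open>x\<^sub>1, \<dots>, x\<^sub>m\<close>; \<open>X0\<close> is \<open>x\<^sub>0\<close>. Words are lists read from left to
  right. For \<open>'m\<close> finite, \<open>m = CARD('m) \<ge> 1\<close>.
\<close>

datatype 'm letter = X0 | Xi 'm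

type_synonym 'm word = "'m letter list"
type_synonym 'm H = "('m \<times> 'm word) mpoly"
type_synonym 'm H2 = "('m \<times> 'm word) mpoly2"

definition coord :: "'m \<Rightarrow> 'm word \<Rightarrow> 'm H" where
  "coord k \<eta> = var (k, \<eta>)"

definition \<theta> :: "'m letter \<Rightarrow> 'm H \<Rightarrow> 'm H" where
  "\<theta> x = deriv_ext (\<lambda>(k, \<eta>). coord k (\<eta> @ [x]))"

definition mult_coord :: "'m \<Rightarrow> 'm H \<Rightarrow> 'm H" where
  "mult_coord j p = coord j [] * p"

definition \<Theta> :: "'m::finite letter \<Rightarrow> 'm H2 \<Rightarrow> 'm H2" where
  "\<Theta> x t = tensor_map (\<theta> x) id t + tensor_map id (\<theta> x) t
     + (if x = X0 then \<Sum>j\<in>UNIV. tensor_map (\<theta> (Xi j)) (mult_coord j) t else 0)"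

text \<open>\<open>fold F [x\<^sub>1, \<dots>, x\<^sub>n] = F x\<^sub>n \<circ> \<dots> \<circ> F x\<^sub>1\<close>, so the first letter acts first.\<close>

definition \<Theta>_word :: "'m::finite word \<Rightarrow> 'm H2 \<Rightarrow> 'm H2" where
  "\<Theta>_word \<eta> = fold \<Theta> \<eta>"

definition coproduct :: "'m::finite H \<Rightarrow> 'm H2" where
  "coproduct = alg_ext (\<lambda>(l, \<eta>). \<Theta>_word \<eta> (coord l [] \<otimes> 1 + 1 \<otimes> coord l []))"

definition counit :: "'m H \<Rightarrow> real" where
  "counit = alg_ext (\<lambda>_. 0)"

definition convolution ::
  "('m::finite H \<Rightarrow> 'm H) \<Rightarrow> ('m H \<Rightarrow> 'm H) \<Rightarrow> 'm H \<Rightarrow> 'm H"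
where
  "convolution f g p = mult_tensor (tensor_map f g (coproduct p))"

definition is_antipode :: "('m::finite H \<Rightarrow> 'm H) \<Rightarrow> bool" where
  "is_antipode S \<longleftrightarrow> linear S
     \<and> convolution S id = (\<lambda>p. counit p *\<^sub>R 1)
     \<and> convolution id S = (\<lambda>p. counit p *\<^sub>R 1)"

definition antipode :: "'m::finite H \<Rightarrow> 'm H" where
  "antipode = (THE S. is_antipode S)"

definition \<theta>' :: "'m::finite letter \<Rightarrow> 'm H \<Rightarrow> 'm H" where
  "\<theta>' x p = - \<theta> x p + (if x = X0 then \<Sum>j\<in>UNIV. coord j [] * \<theta> (Xi j) p else 0)"

definition \<Theta>'_word :: "'m::finite word \<Rightarrow> 'm H \<Rightarrow> 'm H" where
  "\<Theta>'_word \<eta> = fold \<theta>' \<eta>"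

lemma \<theta>_coord: "\<theta> x (coord k \<eta>) = coord k (\<eta> @ [x])"
  by (simp add: \<theta>_def coord_def)

lemma \<theta>_mult: "\<theta> x (p * q) = \<theta> x p * q + p * \<theta> x q"
  by (simp add: \<theta>_def deriv_ext_mult)

lemma coproduct_coord:
  "coproduct (coord l \<eta>) = \<Theta>_word \<eta> (coord l [] \<otimes> 1 + 1 \<otimes> coord l [])"
  by (simp add: coproduct_def coord_def)

lemma coproduct_mult: "coproduct (p * q) = coproduct p * coproduct q"
  by (simp add: coproduct_def alg_ext_mult)

end

theory Submission
  imports Defs
begin

text \<open>
  Let \<open>T\<close> (\<open>anti_morphism\<close> below) be the algebra morphism that takes the claimed values on the
  coordinate functions; the same formula for the empty word gives \<open>T a\<^sub>e = - a\<^sub>e\<close>. The claimed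
  values satisfy \<open>T \<theta>\<^sub>i = - \<theta>'\<^sub>i T = \<theta>\<^sub>i T - \<delta>\<^sub>0\<^sub>i \<Sum>\<^sub>j a\<^sup>j\<^sub>e \<theta>\<^sub>j T\<close> on coordinate functions,
  hence everywhere, since \<open>\<theta>\<^sub>i\<close> and \<open>\<theta>'\<^sub>i\<close> are derivations. It remains to see that \<open>T\<close> is the
  antipode.

  \<^item> \<open>T\<close> is a two-sided convolution inverse of the identity. The extra term in \<open>T \<theta>\<^sub>i\<close> cancels the
    extra term of \<open>\<Theta>\<^sub>i\<close>, so \<open>\<mu> = mult (T \<otimes> id)\<close> satisfies \<open>\<mu> \<Theta>\<^sub>i = \<theta>\<^sub>i \<mu>\<close>; since
    \<open>T a\<^sub>e = - a\<^sub>e\<close>, the map \<open>\<nu> = mult (id \<otimes> T)\<close> satisfies \<open>\<nu> \<Theta>\<^sub>i = - \<theta>'\<^sub>i \<nu>\<close>. Both kernels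
    are thus stable under all \<open>\<Theta>\<^sub>i\<close>. They contain \<open>a\<^sub>e \<otimes> 1 + 1 \<otimes> a\<^sub>e\<close>, hence the coproduct of every
    coordinate function, which is obtained from this element by applying the \<open>\<Theta>\<^sub>i\<close>. As both
    convolutions are algebra morphisms, they equal the counit
    (\<open>convolution_eq_counitI\<close>, \<open>is_antipode_anti_morphism\<close>).

  \<^item> A left convolution inverse is unique. The elements \<open>\<Delta>(p) (1 \<otimes> q)\<close> span \<open>H \<otimes> H\<close>
    (\<open>galois_span_UNIV\<close>), and the value of \<open>mult (S \<otimes> id)\<close> on such an element is
    \<open>(S * id)(p) q\<close>. So \<open>S * id\<close> determines \<open>mult (S \<otimes> id)\<close> and, on \<open>p \<otimes> 1\<close>, determines \<open>S\<close>.
    The spanning property replaces the usual argument from coassociativity: the span is a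
    subalgebra stable under the \<open>\<Theta>\<^sub>i\<close>, and the elements \<open>a\<^sub>\<eta> \<otimes> 1\<close> arise in it from
    \<open>a\<^sub>e \<otimes> 1 = \<Delta>(a\<^sub>e) - 1 \<otimes> a\<^sub>e\<close> by induction on \<open>\<eta>\<close>.
\<close>

section \<open>Polynomials and tensors\<close>

lemma poly_mapping_add_single_induct [case_names zero add_single]:
  assumes "P 0" "\<And>p x c. P p \<Longrightarrow> P (p + Poly_Mapping.single x c)"
  shows "P p"
proof (induction p rule: update_induct)
  case const
  then show ?case by (rule assms)
next
  case (update p x c)
  then have "Poly_Mapping.update x c p = p + Poly_Mapping.single x c"
    by (intro poly_mapping_eqI)
       (auto simp: lookup_update lookup_add lookup_single when_def in_keys_iff)
  then show ?case using assms(2)[OF update(3)] by simp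
qed

lemma mpoly_induct [case_names const var add mult]:
  fixes p :: "'v mpoly"
  assumes const: "\<And>c. P (c *\<^sub>R 1)"
    and var: "\<And>v. P (var v)"
    and add: "\<And>p q. P p \<Longrightarrow> P q \<Longrightarrow> P (p + q)"
    and mult: "\<And>p q. P p \<Longrightarrow> P q \<Longrightarrow> P (p * q)"
  shows "P p"
proof -
  have one: "P 1" using const[of 1] by simp
  have power: "P (Poly_Mapping.single (Poly_Mapping.single v n) 1)" for v n
  proof (induction n)
    case 0
    then show ?case using one by simp
  next
    case (Suc n)
    have "Poly_Mapping.single (Poly_Mapping.single v (Suc n)) (1::real)
        = var v * Poly_Mapping.single (Poly_Mapping.single v n) 1"
      by (simp add: var_def mult_single flip: single_add)
    then show ?case using mult[OF var Suc.IH] by simp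
  qed
  have mono: "P (Poly_Mapping.single u 1)" for u
  proof (induction u rule: poly_mapping_add_single_induct)
    case zero
    then show ?case using one by simp
  next
    case (add_single u v n)
    then show ?case
      using mult[OF add_single power[of v n]] by (simp add: mult_single)
  qed
  have "P (Poly_Mapping.single u c)" for u c
    using mult[OF const[of c] mono[of u]] by (simp add: scaleR_single)
  then show ?thesis
    using const[of 0]
    by (induction p rule: poly_mapping_add_single_induct) (simp_all add: add)
qed

lemma linear_eq_on_tensors:
  fixes f g :: "'v mpoly2 \<Rightarrow> 'b::real_vector"
  assumes "linear f" "linear g" "\<And>p q. f (p \<otimes> q) = g (p \<otimes> q)"
  shows "f t = g t"
proof (rule linear_eq_on_basis[OF assms(1,2)])
  show "f (Poly_Mapping.single x 1) = g (Poly_Mapping.single x 1)" for x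
    using assms(3)[of "Poly_Mapping.single (fst x) 1" "Poly_Mapping.single (snd x) 1"] by simp
qed

lemma bilinear_eq_on_tensors:
  fixes f g :: "'v mpoly2 \<Rightarrow> 'v mpoly2 \<Rightarrow> 'b::real_vector"
  assumes "\<And>t. linear (\<lambda>s. f s t)" "\<And>s. linear (f s)"
    "\<And>t. linear (\<lambda>s. g s t)" "\<And>s. linear (g s)"
    "\<And>p q p' q'. f (p \<otimes> q) (p' \<otimes> q') = g (p \<otimes> q) (p' \<otimes> q')"
  shows "f s t = g s t"
proof -
  have "f (p \<otimes> q) t = g (p \<otimes> q) t" for p q
    by (rule linear_eq_on_tensors[OF assms(2,4)]) (rule assms(5))
  then show ?thesis
    by (rule linear_eq_on_tensors[OF assms(1,3)])
qed

lemma tensor_one_one: "1 \<otimes> 1 = (1 :: 'v mpoly2)"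
  using tensor_single[of 0 1 0 1] by (simp flip: zero_prod_def)

definition alg_hom :: "('a::real_algebra_1 \<Rightarrow> 'b::real_algebra_1) \<Rightarrow> bool" where
  "alg_hom f \<longleftrightarrow> linear f \<and> f 1 = 1 \<and> (\<forall>p q. f (p * q) = f p * f q)"

lemma alg_homD:
  assumes "alg_hom f"
  shows "linear f" "f 1 = 1" "f (p * q) = f p * f q"
  using assms by (simp_all add: alg_hom_def)

lemma alg_hom_alg_ext: "alg_hom (alg_ext f)"
  by (simp add: alg_hom_def linear_alg_ext alg_ext_mult)

lemma alg_hom_id: "alg_hom id"
  by (simp add: alg_hom_def linear_id)

lemma alg_hom_comp: "alg_hom f \<Longrightarrow> alg_hom g \<Longrightarrow> alg_hom (\<lambda>p. f (g p))"
  using linear_compose[of g f] by (simp add: alg_hom_def o_def)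

lemma alg_hom_tensor_map:
  assumes "alg_hom f" "alg_hom g"
  shows "alg_hom (tensor_map f g)"
proof -
  have l: "linear f" "linear g" using assms by (auto simp: alg_hom_def)
  have "tensor_map f g (s * t) = tensor_map f g s * tensor_map f g t" for s t
  proof (rule bilinear_eq_on_tensors[where f = "\<lambda>s t. tensor_map f g (s * t)"
        and g = "\<lambda>s t. tensor_map f g s * tensor_map f g t"])
    show "tensor_map f g (p \<otimes> q * (p' \<otimes> q')) = tensor_map f g (p \<otimes> q) * tensor_map f g (p' \<otimes> q')"
      for p q p' q'
      using assms by (simp add: tensor_mult tensor_map_tensor l alg_hom_def)
  qed (rule linearI; simp add: algebra_simps linear_add[OF linear_tensor_map]
        linear_scale[OF linear_tensor_map])+
  moreover have "tensor_map f g 1 = 1"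
    using assms by (simp add: tensor_map_tensor l alg_hom_def tensor_one_one flip: tensor_one_one)
  ultimately show ?thesis by (simp add: alg_hom_def linear_tensor_map)
qed

lemma alg_hom_mult_tensor: "alg_hom (mult_tensor :: 'v mpoly2 \<Rightarrow> 'v mpoly)"
proof -
  have "mult_tensor (s * t) = mult_tensor s * mult_tensor t" for s t :: "'v mpoly2"
  proof (rule bilinear_eq_on_tensors[where f = "\<lambda>s t. mult_tensor (s * t)"
        and g = "\<lambda>s t. mult_tensor s * mult_tensor t"])
    show "mult_tensor (p \<otimes> q * (p' \<otimes> q')) = mult_tensor (p \<otimes> q) * mult_tensor (p' \<otimes> q')"
      for p q p' q' :: "'v mpoly"
      by (simp add: tensor_mult mult_tensor_tensor ac_simps)
  qed (rule linearI; simp add: algebra_simps linear_add[OF linear_mult_tensor]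
        linear_scale[OF linear_mult_tensor])+
  moreover have "mult_tensor (1 :: 'v mpoly2) = 1"
    using mult_tensor_tensor[of 1 1] by (simp add: tensor_one_one)
  ultimately show ?thesis by (simp add: alg_hom_def linear_mult_tensor)
qed

section \<open>The derivations\<close>

lemma linear_\<theta>: "linear (\<theta> x)"
  unfolding \<theta>_def by (rule linear_deriv_ext)

lemma linear_mult_coord: "linear (mult_coord j)"
  by (rule linearI) (simp_all add: mult_coord_def algebra_simps)

lemma linear_\<Theta>: "linear (\<Theta> x)"
  by (rule linearI)
     (simp_all add: \<Theta>_def linear_add[OF linear_tensor_map] linear_scale[OF linear_tensor_map]
        sum.distrib scaleR_sum_right algebra_simps)

lemma linear_\<theta>': "linear (\<theta>' x)"
  by (rule linearI)
     (simp_all add: \<theta>'_def linear_add[OF linear_\<theta>] linear_scale[OF linear_\<theta>]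
        sum.distrib scaleR_sum_right algebra_simps)

lemma \<theta>_one: "\<theta> x 1 = 0"
  by (simp add: \<theta>_def)

lemma \<theta>'_one: "\<theta>' x 1 = 0"
  by (simp add: \<theta>'_def \<theta>_one)

lemma \<theta>'_mult: "\<theta>' x (p * q) = \<theta>' x p * q + p * \<theta>' x q"
  by (simp add: \<theta>'_def \<theta>_mult algebra_simps sum.distrib sum_distrib_left)

lemma \<Theta>_tensor:
  "\<Theta> x (p \<otimes> q) = \<theta> x p \<otimes> q + p \<otimes> \<theta> x q
     + (if x = X0 then \<Sum>j\<in>UNIV. \<theta> (Xi j) p \<otimes> (coord j [] * q) else 0)"
  by (simp add: \<Theta>_def tensor_map_tensor linear_\<theta> linear_mult_coord linear_id mult_coord_def)

text \<open>The summands \<open>\<theta> j \<otimes> A j\<close> are derivations too, because \<open>A j\<close> is a multiplication operator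
  on a commutative algebra.\<close>

lemma \<Theta>_mult: "\<Theta> x (s * t) = \<Theta> x s * t + s * \<Theta> x t"
proof (rule bilinear_eq_on_tensors[where f = "\<lambda>s t. \<Theta> x (s * t)"
      and g = "\<lambda>s t. \<Theta> x s * t + s * \<Theta> x t"])
  show "\<Theta> x (p \<otimes> q * (p' \<otimes> q')) = \<Theta> x (p \<otimes> q) * (p' \<otimes> q') + p \<otimes> q * \<Theta> x (p' \<otimes> q')"
    for p q p' q'
    by (simp add: tensor_mult \<Theta>_tensor \<theta>_mult distrib_left distrib_right sum_distrib_left
        sum_distrib_right tensor_linear sum.distrib ac_simps)
qed (rule linearI; simp add: distrib_left distrib_right scaleR_add_right
      linear_add[OF linear_\<Theta>] linear_scale[OF linear_\<Theta>])+

lemma \<Theta>_one: "\<Theta> x 1 = 0"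
  using \<Theta>_mult[of x 1 1] by simp

lemma \<Theta>_one_tensor: "\<Theta> x (1 \<otimes> q) = 1 \<otimes> \<theta> x q"
  by (simp add: \<Theta>_tensor \<theta>_one linear_0[OF linear_tensor_left])

section \<open>The coproduct\<close>

lemma alg_hom_coproduct: "alg_hom coproduct"
  unfolding coproduct_def by (rule alg_hom_alg_ext)

lemma coproduct_one: "coproduct 1 = 1"
  by (rule alg_homD[OF alg_hom_coproduct])

lemma linear_coproduct: "linear coproduct"
  by (rule alg_homD[OF alg_hom_coproduct])

lemma coproduct_\<theta>: "coproduct (\<theta> x p) = \<Theta> x (coproduct p)"
proof (induction p rule: mpoly_induct)
  case (const c)
  then show ?case
    by (simp add: linear_scale[OF linear_\<theta>] linear_scale[OF linear_\<Theta>] linear_scale[OF linear_coproduct]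
        linear_0[OF linear_coproduct] \<theta>_one coproduct_one \<Theta>_one)
next
  case (var v)
  obtain k \<eta> where v: "v = (k, \<eta>)" by (cases v)
  show ?case
    using coproduct_coord[of k \<eta>] coproduct_coord[of k "\<eta> @ [x]"] \<theta>_coord[of x k \<eta>]
    by (simp add: v coord_def \<Theta>_word_def)
next
  case (add p q)
  then show ?case
    by (simp add: linear_add[OF linear_\<theta>] linear_add[OF linear_\<Theta>] linear_add[OF linear_coproduct])
next
  case (mult p q)
  then show ?case
    by (simp add: \<theta>_mult \<Theta>_mult coproduct_mult linear_add[OF linear_coproduct])
qed

lemma alg_hom_counit: "alg_hom counit"
  unfolding counit_def by (rule alg_hom_alg_ext)

lemma alg_hom_convolution: "alg_hom f \<Longrightarrow> alg_hom g \<Longrightarrow> alg_hom (convolution f g)"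
  unfolding convolution_def
  by (rule alg_hom_comp[OF alg_hom_mult_tensor
        alg_hom_comp[OF alg_hom_tensor_map alg_hom_coproduct]])

text \<open>
  The coproduct of \<open>a\<^sub>\<eta>\<close> is obtained from \<open>a\<^sub>e \<otimes> 1 + 1 \<otimes> a\<^sub>e\<close> by applying operators \<open>\<Theta> x\<close>, so it
  is annihilated by \<open>mult (f \<otimes> g)\<close> as soon as the kernel of this map is stable under them.
\<close>

lemma convolution_eq_counitI:
  assumes f: "alg_hom f" and g: "alg_hom g"
    and stable: "\<And>x t. mult_tensor (tensor_map f g t) = 0 \<Longrightarrow> mult_tensor (tensor_map f g (\<Theta> x t)) = 0"
    and base: "\<And>k. f (coord k []) + g (coord k []) = 0"
  shows "convolution f g = (\<lambda>p. counit p *\<^sub>R 1)"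
proof
  have hom: "alg_hom (convolution f g)" by (rule alg_hom_convolution[OF f g])
  note counit = alg_homD[OF alg_hom_counit]
  have "mult_tensor (tensor_map f g (\<Theta>_word \<eta> t)) = 0"
    if "mult_tensor (tensor_map f g t) = 0" for \<eta> t
    using that by (induction \<eta> arbitrary: t) (simp_all add: \<Theta>_word_def stable)
  moreover have "mult_tensor (tensor_map f g (coord k [] \<otimes> 1 + 1 \<otimes> coord k [])) = 0" for k
    using f g base by (simp add: alg_hom_def linear_add[OF linear_tensor_map]
        linear_add[OF linear_mult_tensor] tensor_map_tensor mult_tensor_tensor)
  ultimately have coord: "convolution f g (coord k \<eta>) = 0" for k \<eta>
    by (simp add: convolution_def coproduct_coord)
  fix p
  show "convolution f g p = counit p *\<^sub>R 1"
  proof (induction p rule: mpoly_induct)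
    case (const c)
    then show ?case
      by (simp add: linear_scale[OF alg_homD(1)[OF hom]] linear_scale[OF counit(1)]
          alg_homD(2)[OF hom] counit(2))
  next
    case (var v)
    then show ?case
      using coord[of "fst v" "snd v"] by (simp add: coord_def counit_def)
  next
    case (add p q)
    then show ?case
      by (simp add: linear_add[OF alg_homD(1)[OF hom]] linear_add[OF counit(1)] scaleR_add_left)
  next
    case (mult p q)
    then show ?case
      by (simp add: alg_homD(3)[OF hom] counit(3))
  qed
qed

section \<open>The convolution inverse\<close>

definition anti_morphism :: "'m::finite H \<Rightarrow> 'm H" where
  "anti_morphism = alg_ext (\<lambda>(k, \<eta>). (-1) ^ (length \<eta> + 1) * \<Theta>'_word \<eta> (coord k []))"

lemma anti_morphism_coord:
  "anti_morphism (coord k \<eta>) = (-1) ^ (length \<eta> + 1) * \<Theta>'_word \<eta> (coord k [])"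
  by (simp add: anti_morphism_def coord_def)

lemma alg_hom_anti_morphism: "alg_hom anti_morphism"
  unfolding anti_morphism_def by (rule alg_hom_alg_ext)

lemma anti_morphism_hom:
  "linear anti_morphism" "anti_morphism 1 = 1"
  "anti_morphism (p * q) = anti_morphism p * anti_morphism q"
  by (fact alg_homD[OF alg_hom_anti_morphism])+

text \<open>Both sides are derivations along \<open>anti_morphism\<close>, and on coordinate functions the claim
  is the recursion of the formula in the last letter of the word.\<close>

lemma anti_morphism_\<theta>: "anti_morphism (\<theta> x p) = - \<theta>' x (anti_morphism p)"
proof (induction p rule: mpoly_induct)
  case (const c)
  then show ?case
    by (simp add: linear_scale[OF linear_\<theta>] linear_scale[OF linear_\<theta>'] \<theta>_one \<theta>'_one
        linear_scale[OF anti_morphism_hom(1)] linear_0[OF anti_morphism_hom(1)] anti_morphism_hom(2))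
next
  case (var v)
  obtain k \<eta> where v: "v = (k, \<eta>)" by (cases v)
  have sign: "\<theta>' x ((-1) ^ n * p) = (-1) ^ n * \<theta>' x p" for n p
    by (cases "even n") (simp_all add: linear_neg[OF linear_\<theta>'])
  have "anti_morphism (\<theta> x (coord k \<eta>)) = - \<theta>' x (anti_morphism (coord k \<eta>))"
    unfolding \<theta>_coord anti_morphism_coord sign by (simp add: \<Theta>'_word_def)
  then show ?case by (simp add: v coord_def)
next
  case (add p q)
  then show ?case
    by (simp add: linear_add[OF linear_\<theta>] linear_add[OF linear_\<theta>'] linear_add[OF anti_morphism_hom(1)])
next
  case (mult p q)
  then show ?case
    by (simp add: \<theta>_mult \<theta>'_mult anti_morphism_hom(3) linear_add[OF anti_morphism_hom(1)])
qed

lemma anti_morphism_coord_Nil: "anti_morphism (coord k []) = - coord k []"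
  by (simp add: anti_morphism_coord \<Theta>'_word_def)

lemma linear_mult_tensor_map: "linear (\<lambda>t. mult_tensor (tensor_map f g t))"
  using linear_compose[OF linear_tensor_map linear_mult_tensor] by (simp add: o_def)

text \<open>As \<open>\<theta>' (Xi j) = - \<theta> (Xi j)\<close>, the map \<open>anti_morphism\<close> commutes with \<open>\<theta> (Xi j)\<close>. For
  \<open>x = X0\<close> this makes the term \<open>\<theta> (Xi j) \<otimes> A j\<close> of \<open>\<Theta> X0\<close> cancel the correction term by which
  \<open>anti_morphism\<close> fails to commute with \<open>\<theta> X0\<close>.\<close>

lemma mult_anti_id_\<Theta>:
  "mult_tensor (tensor_map anti_morphism id (\<Theta> x t))
     = \<theta> x (mult_tensor (tensor_map anti_morphism id t))"
proof (rule linear_eq_on_tensors[where f = "\<lambda>t. mult_tensor (tensor_map anti_morphism id (\<Theta> x t))"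
      and g = "\<lambda>t. \<theta> x (mult_tensor (tensor_map anti_morphism id t))"])
  note lin = linear_mult_tensor_map[of anti_morphism id]
  show "linear (\<lambda>t. mult_tensor (tensor_map anti_morphism id (\<Theta> x t)))"
    using linear_compose[OF linear_\<Theta> lin] by (simp add: o_def)
  show "linear (\<lambda>t. \<theta> x (mult_tensor (tensor_map anti_morphism id t)))"
    using linear_compose[OF lin linear_\<theta>] by (simp add: o_def)
  have prod: "mult_tensor (tensor_map anti_morphism id (p \<otimes> q)) = anti_morphism p * q" for p q
    by (simp add: tensor_map_tensor anti_morphism_hom(1) linear_id mult_tensor_tensor)
  show "mult_tensor (tensor_map anti_morphism id (\<Theta> x (p \<otimes> q)))
      = \<theta> x (mult_tensor (tensor_map anti_morphism id (p \<otimes> q)))" for p q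
    by (simp add: \<Theta>_tensor linear_add[OF lin] linear_sum[OF lin] linear_0[OF lin] prod
        anti_morphism_\<theta> \<theta>'_def \<theta>_mult algebra_simps sum_distrib_left)
qed

text \<open>Here the term \<open>\<theta> (Xi j) \<otimes> A j\<close> acts on the left factor and contributes
  \<open>anti_morphism (coord j []) = - coord j []\<close>, which has the sign that completes the correction
  term on the right factor to a derivation of the product.\<close>

lemma mult_id_anti_\<Theta>:
  "mult_tensor (tensor_map id anti_morphism (\<Theta> x t))
     = - \<theta>' x (mult_tensor (tensor_map id anti_morphism t))"
proof (rule linear_eq_on_tensors[where f = "\<lambda>t. mult_tensor (tensor_map id anti_morphism (\<Theta> x t))"
      and g = "\<lambda>t. - \<theta>' x (mult_tensor (tensor_map id anti_morphism t))"])
  note lin = linear_mult_tensor_map[of id anti_morphism]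
  show "linear (\<lambda>t. mult_tensor (tensor_map id anti_morphism (\<Theta> x t)))"
    using linear_compose[OF linear_\<Theta> lin] by (simp add: o_def)
  show "linear (\<lambda>t. - \<theta>' x (mult_tensor (tensor_map id anti_morphism t)))"
    using linear_compose[OF lin linear_\<theta>'] by (intro linear_compose_neg) (simp add: o_def)
  have prod: "mult_tensor (tensor_map id anti_morphism (p \<otimes> q)) = p * anti_morphism q" for p q
    by (simp add: tensor_map_tensor anti_morphism_hom(1) linear_id mult_tensor_tensor)
  show "mult_tensor (tensor_map id anti_morphism (\<Theta> x (p \<otimes> q)))
      = - \<theta>' x (mult_tensor (tensor_map id anti_morphism (p \<otimes> q)))" for p q
    by (simp add: \<Theta>_tensor linear_add[OF lin] linear_sum[OF lin] linear_0[OF lin] prod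
        anti_morphism_hom(3) anti_morphism_coord_Nil anti_morphism_\<theta> \<theta>'_def \<theta>_mult algebra_simps sum_distrib_left
        sum.distrib sum_negf)
qed

lemma is_antipode_anti_morphism: "is_antipode anti_morphism"
  unfolding is_antipode_def
proof (intro conjI)
  show "linear anti_morphism" by (rule anti_morphism_hom)
  show "convolution anti_morphism id = (\<lambda>p. counit p *\<^sub>R 1)"
    by (rule convolution_eq_counitI)
       (simp_all add: alg_hom_anti_morphism alg_hom_id mult_anti_id_\<Theta> linear_0[OF linear_\<theta>]
          anti_morphism_coord_Nil)
  show "convolution id anti_morphism = (\<lambda>p. counit p *\<^sub>R 1)"
    by (rule convolution_eq_counitI)
       (simp_all add: alg_hom_anti_morphism alg_hom_id mult_id_anti_\<Theta> linear_0[OF linear_\<theta>']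
          anti_morphism_coord_Nil)
qed

section \<open>Uniqueness of the antipode\<close>

text \<open>The range of the Galois map \<open>p \<otimes> q \<mapsto> \<Delta>(p) (1 \<otimes> q)\<close>.\<close>

definition galois_span :: "'m::finite H2 set" where
  "galois_span = span {coproduct p * (1 \<otimes> q) | p q. True}"

lemma galois_gen: "coproduct p * (1 \<otimes> q) \<in> galois_span"
  unfolding galois_span_def by (rule span_base) blast

lemma galois_subspace:
  "0 \<in> galois_span" "s \<in> galois_span \<Longrightarrow> t \<in> galois_span \<Longrightarrow> s + t \<in> galois_span"
  "s \<in> galois_span \<Longrightarrow> t \<in> galois_span \<Longrightarrow> s - t \<in> galois_span"
  "s \<in> galois_span \<Longrightarrow> c *\<^sub>R s \<in> galois_span"
  unfolding galois_span_def by (fact span_zero span_add span_diff span_scale)+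

lemma galois_sum: "(\<And>j. j \<in> A \<Longrightarrow> f j \<in> galois_span) \<Longrightarrow> sum f A \<in> galois_span"
  unfolding galois_span_def by (rule span_sum)

lemma galois_induct [consumes 1, case_names zero step]:
  assumes "t \<in> galois_span" "P 0"
    and "\<And>c p q s. P s \<Longrightarrow> P (c *\<^sub>R (coproduct p * (1 \<otimes> q)) + s)"
  shows "P t"
  using assms(1) unfolding galois_span_def
  by (rule span_induct_alt[where h = P]) (use assms(2,3) in blast)+

lemma galois_one_tensor: "1 \<otimes> q \<in> galois_span"
  using galois_gen[of 1 q] by (simp add: coproduct_one)

lemma galois_mult:
  assumes "s \<in> galois_span" "t \<in> galois_span"
  shows "s * t \<in> galois_span"
  using assms(1)
proof (induction rule: galois_induct)
  case zero
  then show ?case by (simp add: galois_subspace)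
next
  case (step c p q s)
  have "(coproduct p * (1 \<otimes> q)) * t \<in> galois_span"
    using assms(2)
  proof (induction rule: galois_induct)
    case zero
    then show ?case by (simp add: galois_subspace)
  next
    case (step c' p' q' s')
    have "coproduct p * (1 \<otimes> q) * (coproduct p' * (1 \<otimes> q'))
        = coproduct (p * p') * ((1 \<otimes> q) * (1 \<otimes> q'))"
      by (simp only: coproduct_mult ac_simps)
    also have "\<dots> = coproduct (p * p') * (1 \<otimes> (q * q'))"
      by (simp add: tensor_mult)
    also have "\<dots> \<in> galois_span" by (rule galois_gen)
    finally show ?case
      using step by (simp add: distrib_left galois_subspace)
  qed
  then show ?case using step by (simp add: distrib_right galois_subspace)
qed

lemma galois_\<Theta>:
  assumes "t \<in> galois_span"
  shows "\<Theta> x t \<in> galois_span"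
  using assms
proof (induction rule: galois_induct)
  case zero
  then show ?case by (simp add: linear_0[OF linear_\<Theta>] galois_subspace)
next
  case (step c p q s)
  have "\<Theta> x (coproduct p * (1 \<otimes> q)) = coproduct (\<theta> x p) * (1 \<otimes> q) + coproduct p * (1 \<otimes> \<theta> x q)"
    by (simp add: \<Theta>_mult coproduct_\<theta> \<Theta>_one_tensor)
  then show ?case
    using step by (simp add: linear_add[OF linear_\<Theta>] linear_scale[OF linear_\<Theta>] galois_subspace galois_gen)
qed

lemma galois_coord: "coord k \<eta> \<otimes> 1 \<in> galois_span"
proof (induction \<eta> rule: rev_induct)
  case Nil
  have "coord k [] \<otimes> 1 = coproduct (coord k []) * (1 \<otimes> 1) - 1 \<otimes> coord k []"
    by (simp add: coproduct_coord \<Theta>_word_def tensor_one_one)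
  then show ?case by (metis galois_subspace(3) galois_gen galois_one_tensor)
next
  case (snoc x \<eta>)
  have \<Theta>: "\<Theta> y (coord k \<eta> \<otimes> 1) = coord k (\<eta> @ [y]) \<otimes> 1
      + (if y = X0 then \<Sum>j\<in>UNIV. (coord k (\<eta> @ [Xi j]) \<otimes> 1) * (1 \<otimes> coord j []) else 0)" for y
    by (simp add: \<Theta>_tensor \<theta>_coord \<theta>_one linear_0[OF linear_tensor_right] tensor_mult)
  \<comment> \<open>The letters \<open>Xi j\<close> come first, since the correction term for \<open>X0\<close> is built from them.\<close>
  have Xi: "coord k (\<eta> @ [Xi j]) \<otimes> 1 \<in> galois_span" for j
    using galois_\<Theta>[OF snoc, of "Xi j"] by (simp add: \<Theta>)
  have "(\<Sum>j\<in>UNIV. (coord k (\<eta> @ [Xi j]) \<otimes> 1) * (1 \<otimes> coord j [])) \<in> galois_span"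
    by (intro galois_sum galois_mult Xi galois_one_tensor)
  with galois_\<Theta>[OF snoc, of X0] have "coord k (\<eta> @ [X0]) \<otimes> 1 \<in> galois_span"
    using galois_subspace(3) by (fastforce simp: \<Theta>)
  with Xi show ?case by (cases x) auto
qed

lemma galois_span_UNIV: "galois_span = (UNIV :: 'm::finite H2 set)"
proof -
  have left: "p \<otimes> 1 \<in> galois_span" for p :: "'m H"
  proof (induction p rule: mpoly_induct)
    case (const c)
    then show ?case by (simp add: tensor_linear galois_subspace galois_one_tensor)
  next
    case (var v)
    then show ?case using galois_coord[of "fst v" "snd v"] by (simp add: coord_def)
  next
    case (add p q)
    then show ?case by (simp add: tensor_linear galois_subspace)
  next
    case (mult p q)
    then show ?case using galois_mult[of "p \<otimes> 1" "q \<otimes> 1"] by (simp add: tensor_mult)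
  qed
  have tensor: "p \<otimes> q \<in> galois_span" for p q :: "'m H"
    using galois_mult[OF left[of p] galois_one_tensor[of q]] by (simp add: tensor_mult)
  have basis: "Poly_Mapping.single x c \<in> galois_span"
    for x :: "('m \<times> 'm word) mono \<times> ('m \<times> 'm word) mono" and c :: real
    using tensor[of "Poly_Mapping.single (fst x) c" "Poly_Mapping.single (snd x) 1"] by simp
  have "t \<in> galois_span" for t :: "'m H2"
    by (induction t rule: poly_mapping_add_single_induct) (simp_all add: basis galois_subspace)
  then show ?thesis by blast
qed

text \<open>\<open>mult (S \<otimes> id)\<close> is linear over the right factor, so \<open>S * id\<close> fixes its values on
  \<open>galois_span\<close>.\<close>

lemma convolution_id_cancel:
  assumes S: "linear S" and S': "linear S'" and eq: "convolution S id = convolution S' id"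
  shows "S = S'"
proof
  fix p
  let ?F = "\<lambda>S t. mult_tensor (tensor_map S id t)"
  have tensor: "?F R (p \<otimes> q) = R p * q" if "linear R" for R p q
    by (simp add: tensor_map_tensor that linear_id mult_tensor_tensor)
  have right: "?F R (t * (1 \<otimes> q)) = ?F R t * q" if R: "linear R" for R t q
  proof (rule linear_eq_on_tensors[where f = "\<lambda>t. ?F R (t * (1 \<otimes> q))" and g = "\<lambda>t. ?F R t * q"])
    show "?F R (p' \<otimes> q' * (1 \<otimes> q)) = ?F R (p' \<otimes> q') * q" for p' q'
      by (simp add: tensor_mult tensor R ac_simps)
  qed (rule linearI; simp add: distrib_right linear_add[OF linear_mult_tensor_map]
        linear_scale[OF linear_mult_tensor_map])+
  have gen: "?F S (coproduct p * (1 \<otimes> q)) = ?F S' (coproduct p * (1 \<otimes> q))" for p q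
    using fun_cong[OF eq, of p] by (simp add: right S S' convolution_def)
  have "?F S t = ?F S' t" if "t \<in> galois_span" for t
    using that
    by (induction rule: galois_induct)
       (simp_all add: linear_0[OF linear_mult_tensor_map] linear_add[OF linear_mult_tensor_map]
         linear_scale[OF linear_mult_tensor_map] gen[unfolded id_def])
  then have "?F S (p \<otimes> 1) = ?F S' (p \<otimes> 1)" by (simp add: galois_span_UNIV)
  then show "S p = S' p" by (simp add: tensor S S')
qed

lemma antipode_eq_anti_morphism: "antipode = (anti_morphism :: 'm::finite H \<Rightarrow> 'm H)"
  unfolding antipode_def
proof (rule the_equality)
  show "is_antipode anti_morphism" by (rule is_antipode_anti_morphism)
  show "S = anti_morphism" if "is_antipode S" for S :: "'m H \<Rightarrow> 'm H"
    using that is_antipode_anti_morphism[where 'a = 'm]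
    by - (rule convolution_id_cancel; simp add: is_antipode_def)
qed

theorem theorem8:
  fixes k :: "'m::finite" and \<eta> :: "'m word"
  assumes "\<eta> \<noteq> []"
  shows "antipode (coord k \<eta>) = (-1) ^ (length \<eta> + 1) * \<Theta>'_word \<eta> (coord k [])"
  by (simp only: antipode_eq_anti_morphism anti_morphism_coord)

end
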